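(* Let $\mu$ be a finite positive Borel measure on the interval $[0,1)$. If $0<\beta\le 2$, then $\mathcal{C}_\mu:\mathcal{B}\to\mathcal{B}^{\beta}$ is bounded if and only if $$\sup_{0<t<1}\frac{\mu([t,1))\log\frac{e}{1-t}}{(1-t)^{2-\beta}}<\infty.$$
   Context: Let $\mathbb{D}=\{z\in\mathbb{C}:|z|<1\}$ and let $H(\mathbb{D})$ be the space of all analytic functions in $\mathbb{D}$. For $0<\alpha<\infty$, the Bloch-type space is $\mathcal{B}^{\alpha}=\{f\in H(\mathbb{D}):\|f\|_{\mathcal{B}^\alpha}=|f(0)|+\sup_{z\in\mathbb{D}}(1-|z|^2)^{\alpha}|f'(z)|<\infty\}$, and $\mathcal{B}=\mathcal{B}^1$ is the classical Bloch space. For a finite positive Borel measure $\mu$ on $[0,1)$ and $f(z)=\sum_{n=0}^\infty a_nz^n\in H(\mathbb{D})$, the Cesàro-like operator is $$\mathcal{C}_\mu(f)(z)=\sum_{n=0}^\infty\left(\mu_n\sum_{k=0}^n a_k\right)z^n=\int_{[0,1)}\frac{f(tz)}{1-tz}\,d\mu(t),\quad z\in\mathbb{D},$$ where $\mu_n=\int_{[0,1)}t^n\,d\mu(t)$. *)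

theory Defs
  imports "HOL-Analysis.Analysis" "HOL-Complex_Analysis.Complex_Analysis"
begin

text \<open>
  Functions on the unit disc are represented by total functions on the complex numbers; all
  notions below depend only on their values on the open unit disc. The norm is extended-real
  valued, so that it makes sense for every analytic function and the Bloch-type space consists
  of the analytic functions of finite norm.
\<close>

definition bloch_norm :: "real \<Rightarrow> (complex \<Rightarrow> complex) \<Rightarrow> ereal" where
  "bloch_norm \<alpha> f =
     ereal (norm (f 0)) +
     (SUP z \<in> ball 0 1. ereal ((1 - (norm z)\<^sup>2) powr \<alpha> * norm (deriv f z)))"

definition bloch_space :: "real \<Rightarrow> (complex \<Rightarrow> complex) set" where
  "bloch_space \<alpha> = {f. f holomorphic_on ball 0 1 \<and> bloch_norm \<alpha> f < \<infinity>}"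

definition taylor_coeff :: "(complex \<Rightarrow> complex) \<Rightarrow> nat \<Rightarrow> complex" where
  "taylor_coeff f k = (deriv ^^ k) f 0 / fact k"

definition moment :: "real measure \<Rightarrow> nat \<Rightarrow> real" where
  "moment \<mu> n = (LINT t|\<mu>. t ^ n)"

text \<open>
  For a finite Borel measure on \<open>[0,1)\<close> and \<open>f\<close> analytic in the unit disc, the series
  converges at every point of the disc, so its value there is the genuine sum.
\<close>

definition cesaro_like :: "real measure \<Rightarrow> (complex \<Rightarrow> complex) \<Rightarrow> complex \<Rightarrow> complex" where
  "cesaro_like \<mu> f z =
     (\<Sum>n. (complex_of_real (moment \<mu> n) * (\<Sum>k\<le>n. taylor_coeff f k)) * z ^ n)"

definition bloch_bounded ::
  "((complex \<Rightarrow> complex) \<Rightarrow> (complex \<Rightarrow> complex)) \<Rightarrow> real \<Rightarrow> real \<Rightarrow> bool" where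
  "bloch_bounded T \<alpha> \<beta> \<longleftrightarrow>
     (\<forall>f \<in> bloch_space \<alpha>. T f \<in> bloch_space \<beta>) \<and>
     (\<exists>C::real. \<forall>f \<in> bloch_space \<alpha>. bloch_norm \<beta> (T f) \<le> ereal C * bloch_norm \<alpha> f)"

end

theory Submission
  imports Defs
begin

text \<open>
  Let \<open>h w = f w / (1 - w)\<close>, whose Taylor coefficients are the partial sums of those of \<open>f\<close>.
  Exchanging sum and integral gives \<open>(C\<^sub>\<mu> f)' z = \<integral> t h' (t z) d\<mu>(t)\<close>.

  If \<open>f\<close> is a Bloch function then \<open>f\<close> grows at most like \<open>1 - ln (1 - \<bar>w\<bar>)\<close>, so that \<open>\<bar>h' w\<bar>\<close> is
  dominated by \<open>(1 - ln (1 - \<bar>w\<bar>)) / (1 - \<bar>w\<bar>)\<^sup>2\<close>. With \<open>r = \<bar>z\<bar>\<close>, writing the \<open>\<mu>\<close>-integral of this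
  kernel at \<open>t r\<close> as an integral of its \<open>t\<close>-derivative against the tails \<open>\<mu> [s, 1)\<close>, the tail condition
  cancels the logarithm and leaves \<open>\<integral> r (1 - s r) powr (- \<beta> - 1) ds\<close>, which is of order
  \<open>(1 - r) powr (- \<beta>)\<close>.

  Conversely, the Bloch function \<open>1 - Ln (1 - z)\<close> gives a nonnegative integrand at \<open>z = r\<close> real;
  keeping only the part of the integral over \<open>[r, 1)\<close> yields the tail condition.
\<close>

section \<open>Power series in the disc and the coefficients of \<open>f w / (1 - w)\<close>\<close>

lemma holomorphic_sums_taylor_coeff:
  assumes "f holomorphic_on ball 0 1" "norm w < 1"
  shows "(\<lambda>n. taylor_coeff f n * w ^ n) sums f w"
  using holomorphic_power_series[OF assms(1), of w] assms(2) by (simp add: taylor_coeff_def)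

text \<open>Abel's lemma: convergence at a real point strictly between \<open>norm z\<close> and 1
  makes the terms at \<open>z\<close> decay geometrically.\<close>

lemma summable_norm_powser_unit_disc:
  fixes c :: "nat \<Rightarrow> complex"
  assumes "\<And>w. norm w < 1 \<Longrightarrow> summable (\<lambda>n. c n * w ^ n)" "norm z < 1"
  shows "summable (\<lambda>n. norm (c n * z ^ n))"
proof -
  obtain r where r: "norm z < r" "r < 1"
    using assms(2) dense by blast
  then have nr: "norm (complex_of_real r) = r"
    by (smt (verit) norm_ge_zero norm_of_real)
  then have "summable (\<lambda>n. c n * complex_of_real r ^ n)"
    using assms(1) r by simp
  then show ?thesis
    by (rule powser_insidea) (use r nr in simp)
qed

text \<open>Division by \<open>1 - w\<close> is multiplication by the geometric series, and the
  Cauchy product with a series of ones as coefficients sums the coefficients up.\<close>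

lemma sums_taylor_coeff_partial_sums:
  assumes "f holomorphic_on ball 0 1" "norm w < 1"
  shows "(\<lambda>n. (\<Sum>k\<le>n. taylor_coeff f k) * w ^ n) sums (f w / (1 - w))"
proof -
  have a: "summable (\<lambda>n. norm (taylor_coeff f n * w ^ n))"
    using holomorphic_sums_taylor_coeff[OF assms(1)] assms(2)
    by (intro summable_norm_powser_unit_disc) (auto simp: sums_iff)
  have b: "summable (\<lambda>n. norm (w ^ n))"
    using assms(2) by (simp add: norm_power)
  have "(\<Sum>i\<le>n. taylor_coeff f i * w ^ i * w ^ (n - i)) = (\<Sum>k\<le>n. taylor_coeff f k) * w ^ n" for n
    unfolding sum_distrib_right by (rule sum.cong) (simp_all add: mult.assoc flip: power_add)
  moreover have "(\<Sum>n. taylor_coeff f n * w ^ n) * (\<Sum>n. w ^ n) = f w / (1 - w)"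
    using holomorphic_sums_taylor_coeff[OF assms] assms(2)
    by (simp add: sums_iff suminf_geometric)
  ultimately show ?thesis
    using Cauchy_product_sums[OF a b] by simp
qed

section \<open>Integration against a finite measure on [0,1), and the derivative of the
  operator\<close>

locale disc_measure = finite_measure \<mu> for \<mu> :: "real measure" +
  assumes sets_eq: "sets \<mu> = sets (restrict_space borel {0..<1})"
begin

text \<open>Equal sigma-algebras have equal top sets, so the underlying space is the interval
  itself. Pointwise bounds therefore only have to be checked for 0 \<le> t < 1, and every tail
  \<open>{s..<1}\<close> with s \<ge> 0 is measurable.\<close>

lemma space_eq: "space \<mu> = {0..<1}"
  using sets_eq_imp_space_eq[OF sets_eq] by (simp add: space_restrict_space)

lemma measurable_eq: "measurable \<mu> N = measurable (restrict_space borel {0..<1}) N"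
  by (rule measurable_cong_sets[OF sets_eq refl])

lemma measurable_borelI [measurable (raw)]:
  "f \<in> borel_measurable borel \<Longrightarrow> f \<in> borel_measurable \<mu>"
  by (simp add: measurable_eq measurable_restrict_space1)

lemma measurable_ident: "(\<lambda>t. t) \<in> borel_measurable \<mu>"
  by (rule measurable_borelI) simp

lemma Ico_in_sets: "0 \<le> s \<Longrightarrow> {s..<1} \<in> sets \<mu>"
  unfolding sets_eq sets_restrict_space by (auto intro!: image_eqI[of _ _ "{s..<1}"])

lemma integrable_bounded:
  fixes f :: "real \<Rightarrow> 'b::{banach, second_countable_topology}"
  assumes "f \<in> borel_measurable \<mu>" "\<And>t. 0 \<le> t \<Longrightarrow> t < 1 \<Longrightarrow> norm (f t) \<le> B"
  shows "integrable \<mu> f"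
  using assms by (intro integrable_const_bound[of _ B]) (auto simp: space_eq)

lemma moment_bounds: "0 \<le> moment \<mu> n" "moment \<mu> n \<le> measure \<mu> (space \<mu>)"
proof -
  have *: "integrable \<mu> (\<lambda>t. t ^ n)"
    by (rule integrable_bounded[of _ 1])
       (auto intro!: borel_measurable_power measurable_ident power_le_one)
  show "0 \<le> moment \<mu> n"
    unfolding moment_def by (intro Bochner_Integration.integral_nonneg) (auto simp: space_eq)
  have "(LINT t|\<mu>. t ^ n) \<le> (LINT t|\<mu>. 1)"
    by (rule integral_mono[OF *]) (auto simp: space_eq power_le_one)
  then show "moment \<mu> n \<le> measure \<mu> (space \<mu>)"
    by (simp add: moment_def)
qed

text \<open>The moments are bounded by the total mass, so inserting them into the absolutely
  convergent series of \<open>f z / (1 - z)\<close> preserves convergence.\<close>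

lemma summable_cesaro_like:
  assumes "f holomorphic_on ball 0 1" "norm z < 1"
  shows "summable (\<lambda>n. (complex_of_real (moment \<mu> n) * (\<Sum>k\<le>n. taylor_coeff f k)) * z ^ n)"
proof -
  have "summable (\<lambda>n. norm ((\<Sum>k\<le>n. taylor_coeff f k) * z ^ n))"
    using sums_taylor_coeff_partial_sums[OF assms(1)] assms(2)
    by (intro summable_norm_powser_unit_disc) (auto simp: sums_iff)
  then have "summable (\<lambda>n. measure \<mu> (space \<mu>) * norm ((\<Sum>k\<le>n. taylor_coeff f k) * z ^ n))"
    by (rule summable_mult)
  then show ?thesis
    by (rule summable_comparison_test'[where N=0])
       (auto simp: norm_mult mult.assoc moment_bounds intro!: mult_right_mono)
qed

lemma cesaro_like_0: "cesaro_like \<mu> f 0 = complex_of_real (measure \<mu> (space \<mu>)) * f 0"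
  unfolding cesaro_like_def powser_zero by (simp add: moment_def taylor_coeff_def)

lemma holomorphic_cesaro_like:
  assumes "f holomorphic_on ball 0 1"
  shows "cesaro_like \<mu> f holomorphic_on ball 0 1"
proof -
  have "(cesaro_like \<mu> f has_field_derivative
      (\<Sum>n. diffs (\<lambda>n. complex_of_real (moment \<mu> n) * (\<Sum>k\<le>n. taylor_coeff f k)) n * z ^ n)) (at z)"
    if "norm z < 1" for z
    unfolding cesaro_like_def[abs_def]
    by (rule termdiffs_strong'[OF summable_cesaro_like[OF assms] that])
  then show ?thesis
    by (metis dist_0_norm holomorphic_on_open mem_ball open_ball)
qed

text \<open>The series of \<open>deriv h\<close> at \<open>t z\<close> is dominated, uniformly in t,
  by its absolutely convergent series at \<open>z\<close>. Since the measure is finite, this permits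
  the exchange of sum and integral; the result is the termwise derivative of the defining
  series.\<close>

lemma deriv_cesaro_like:
  assumes f: "f holomorphic_on ball 0 1" and z: "norm z < 1"
  defines "h \<equiv> \<lambda>w. f w / (1 - w)"
  shows "integrable \<mu> (\<lambda>t. of_real t * deriv h (of_real t * z))" (is ?int)
    and "deriv (cesaro_like \<mu> f) z = (LINT t|\<mu>. of_real t * deriv h (of_real t * z))" (is ?eq)
proof -
  define A where "A n = (\<Sum>k\<le>n. taylor_coeff f k)" for n
  have A: "(\<lambda>n. A n * w ^ n) sums h w" if "norm w < 1" for w
    using sums_taylor_coeff_partial_sums[OF f that] by (simp add: A_def h_def)
  have hol: "h holomorphic_on ball 0 1"
    unfolding h_def using f by (intro holomorphic_intros) auto
  have h': "(\<lambda>n. diffs A n * w ^ n) sums deriv h w" if "norm w < 1" for w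
    using holomorphic_derivI[OF hol] that by (intro termdiffs_sums_strong[OF A]) auto
  \<comment> \<open>The extra factor t raises \<open>t ^ n\<close> to \<open>t ^ Suc n\<close>,
    whose integral is the moment with the index shifted as in \<open>diffs\<close>.\<close>
  let ?g = "\<lambda>n t. complex_of_real t * (diffs A n * (of_real t * z) ^ n)"
  have sums_g: "(\<lambda>n. ?g n t) sums (of_real t * deriv h (of_real t * z))" if "0 \<le> t" "t < 1" for t
  proof (rule sums_mult[OF h'])
    have "\<bar>t\<bar> * norm z \<le> 1 * norm z"
      using that by (intro mult_right_mono) auto
    with z show "norm (complex_of_real t * z) < 1"
      by (simp add: norm_mult)
  qed
  have sum: "summable (\<lambda>n. norm (diffs A n * z ^ n))"
    using h' z by (intro summable_norm_powser_unit_disc) (auto simp: sums_iff)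
  have bound: "norm (?g n t) \<le> norm (diffs A n * z ^ n)" if "0 \<le> t" "t < 1" for n t
  proof -
    have "norm (?g n t) = t ^ Suc n * norm (diffs A n * z ^ n)"
      using that by (simp add: norm_mult norm_power power_mult_distrib)
    also have "\<dots> \<le> 1 * norm (diffs A n * z ^ n)"
      using that by (intro mult_right_mono power_le_one) auto
    finally show ?thesis by simp
  qed
  have meas: "?g n \<in> borel_measurable \<mu>" for n
    by (rule measurable_borelI) simp
  have int: "integrable \<mu> (?g n)" for n
    by (rule integrable_bounded[OF meas bound])
  have AE: "AE t in \<mu>. summable (\<lambda>n. norm (?g n t))"
    by (auto simp: space_eq intro!: AE_I2 summable_comparison_test'[where N=0, OF sum] bound)
  have "(LINT t|\<mu>. norm (?g n t)) \<le> (LINT t|\<mu>. norm (diffs A n * z ^ n))" for n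
    by (rule integral_mono[OF integrable_norm[OF int]]) (auto simp: space_eq intro!: bound)
  then have le: "(LINT t|\<mu>. norm (?g n t)) \<le> measure \<mu> (space \<mu>) * norm (diffs A n * z ^ n)" for n
    by simp
  have sumint: "summable (\<lambda>n. LINT t|\<mu>. norm (?g n t))"
    using le by (intro summable_comparison_test'[where N=0, OF summable_mult[OF sum]])
                (auto intro!: Bochner_Integration.integral_nonneg)
  have eq: "(\<Sum>n. ?g n t) = of_real t * deriv h (of_real t * z)" if "t \<in> space \<mu>" for t
    using sums_g[of t] that by (simp add: space_eq sums_iff)
  show ?int
    using integrable_suminf[OF int AE sumint]
    by (rule Bochner_Integration.integrable_cong[THEN iffD1, rotated 2]) (simp_all only: eq)
  have "(LINT t|\<mu>. ?g n t) =
      diffs (\<lambda>n. complex_of_real (moment \<mu> n) * A n) n * z ^ n" for n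
  proof -
    have "?g n t = (diffs A n * z ^ n) * complex_of_real (t ^ Suc n)" for t
      by (simp add: power_mult_distrib)
    then have "(LINT t|\<mu>. ?g n t) = (diffs A n * z ^ n) * complex_of_real (moment \<mu> (Suc n))"
      unfolding moment_def by (simp only: integral_mult_right_zero integral_complex_of_real)
    then show ?thesis by (simp add: diffs_def mult_ac)
  qed
  moreover have "(LINT t|\<mu>. of_real t * deriv h (of_real t * z)) = (LINT t|\<mu>. (\<Sum>n. ?g n t))"
    by (rule Bochner_Integration.integral_cong) (simp_all only: eq)
  ultimately have "(LINT t|\<mu>. of_real t * deriv h (of_real t * z)) =
      (\<Sum>n. diffs (\<lambda>n. complex_of_real (moment \<mu> n) * A n) n * z ^ n)"
    using integral_suminf[OF int AE sumint] by simp
  moreover have "(cesaro_like \<mu> f has_field_derivative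
      (\<Sum>n. diffs (\<lambda>n. complex_of_real (moment \<mu> n) * A n) n * z ^ n)) (at z)"
    unfolding cesaro_like_def[abs_def] A_def
    by (rule termdiffs_strong'[OF summable_cesaro_like[OF f] z])
  ultimately show ?eq
    by (metis DERIV_imp_deriv)
qed

text \<open>Write \<open>G t\<close> as \<open>G 0\<close> plus the integral of \<open>G'\<close>
  over [0,t] and apply Tonelli: for fixed s, the points t with s \<le> t form the tail
  \<open>{s..<1}\<close>. Working with nonnegative extended integrals avoids any integrability
  hypothesis.\<close>

lemma nn_integral_layer_cake:
  fixes G G' :: "real \<Rightarrow> real"
  assumes [measurable]: "G' \<in> borel_measurable borel"
    and deriv: "\<And>x. 0 \<le> x \<Longrightarrow> x < 1 \<Longrightarrow> (G has_real_derivative G' x) (at x)"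
    and nonneg: "\<And>x. 0 \<le> x \<Longrightarrow> x < 1 \<Longrightarrow> 0 \<le> G' x" "0 \<le> G 0"
  shows "(\<integral>\<^sup>+t. ennreal (G t) \<partial>\<mu>) = ennreal (G 0) * emeasure \<mu> (space \<mu>) +
    (\<integral>\<^sup>+s. ennreal (G' s) * indicator {0..<1} s * emeasure \<mu> {s..<1} \<partial>lborel)"
proof -
  interpret pair_sigma_finite lborel \<mu> ..
  have G: "ennreal (G t) = ennreal (G 0) + (\<integral>\<^sup>+s. ennreal (G' s) * indicator {0..t} s \<partial>lborel)"
    if "t \<in> space \<mu>" for t
  proof -
    have t: "0 \<le> t" "t < 1" using that by (auto simp: space_eq)
    have "G 0 \<le> G t"
      by (rule DERIV_nonneg_imp_nondecreasing[OF t(1)]) (use t deriv nonneg in force)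
    moreover have "(\<integral>\<^sup>+s. ennreal (G' s) * indicator {0..t} s \<partial>lborel) = ennreal (G t - G 0)"
      using t deriv nonneg
      by (intro nn_integral_FTC_Icc) (auto intro: has_field_derivative_at_within)
    ultimately show ?thesis
      using nonneg(2) by (simp flip: ennreal_plus)
  qed
  have [measurable]: "(\<lambda>t. t) \<in> borel_measurable \<mu>"
    by (rule measurable_ident)
  have m: "(\<lambda>(s, t). ennreal (G' s) * indicator {0..t} s) \<in> borel_measurable (lborel \<Otimes>\<^sub>M \<mu>)"
  proof -
    \<comment> \<open>An interval with a variable endpoint is turned into a condition on the pair,
      for which joint measurability is automatic.\<close>
    have "(\<lambda>(s, t). ennreal (G' s) * indicator {0..t} s) =
        (\<lambda>(s, t). ennreal (G' s) * (if 0 \<le> s \<and> s \<le> t then 1 else 0))"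
      by (auto simp: fun_eq_iff indicator_def)
    also have "\<dots> \<in> borel_measurable (lborel \<Otimes>\<^sub>M \<mu>)"
      by measurable
    finally show ?thesis .
  qed
  have "(\<integral>\<^sup>+t. ennreal (G t) \<partial>\<mu>) =
      (\<integral>\<^sup>+t. ennreal (G 0) + (\<integral>\<^sup>+s. ennreal (G' s) * indicator {0..t} s \<partial>lborel) \<partial>\<mu>)"
    by (rule nn_integral_cong[OF G])
  also have "\<dots> = ennreal (G 0) * emeasure \<mu> (space \<mu>) +
      (\<integral>\<^sup>+t. (\<integral>\<^sup>+s. ennreal (G' s) * indicator {0..t} s \<partial>lborel) \<partial>\<mu>)"
    using measurable_pair_swap[OF m]
    by (subst nn_integral_add) (auto simp: split_def intro!: lborel.borel_measurable_nn_integral)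
  also have "(\<integral>\<^sup>+t. (\<integral>\<^sup>+s. ennreal (G' s) * indicator {0..t} s \<partial>lborel) \<partial>\<mu>) =
      (\<integral>\<^sup>+s. (\<integral>\<^sup>+t. ennreal (G' s) * indicator {0..t} s \<partial>\<mu>) \<partial>lborel)"
    by (rule Fubini'[OF m])
  also have "\<dots> = (\<integral>\<^sup>+s. ennreal (G' s) * indicator {0..<1} s * emeasure \<mu> {s..<1} \<partial>lborel)"
  proof (rule nn_integral_cong)
    fix s :: real
    show "(\<integral>\<^sup>+t. ennreal (G' s) * indicator {0..t} s \<partial>\<mu>) =
        ennreal (G' s) * indicator {0..<1} s * emeasure \<mu> {s..<1}"
    \<comment> \<open>For s < 0 both indicators vanish; for s \<ge> 1 the tail is empty.\<close>
    proof (cases "0 \<le> s")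
      case True
      have "(\<integral>\<^sup>+t. ennreal (G' s) * indicator {0..t} s \<partial>\<mu>) =
          (\<integral>\<^sup>+t. ennreal (G' s) * indicator {s..<1} t \<partial>\<mu>)"
        using True by (intro nn_integral_cong) (auto simp: space_eq indicator_def)
      also have "\<dots> = ennreal (G' s) * emeasure \<mu> {s..<1}"
        by (rule nn_integral_cmult_indicator[OF Ico_in_sets[OF True]])
      finally show ?thesis
        using True by (cases "s < 1") auto
    qed simp
  qed
  finally show ?thesis .
qed

end

section \<open>Bloch norms in real terms and the growth of Bloch functions\<close>

lemma bloch_normE:
  assumes "bloch_norm \<alpha> f < \<infinity>"
  obtains s where "0 \<le> s" "bloch_norm \<alpha> f = ereal (norm (f 0) + s)"
    "\<And>z. norm z < 1 \<Longrightarrow> (1 - (norm z)\<^sup>2) powr \<alpha> * norm (deriv f z) \<le> s"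
proof -
  define S where "S = (SUP z \<in> ball 0 1. ereal ((1 - (norm z)\<^sup>2) powr \<alpha> * norm (deriv f z)))"
  have le: "ereal ((1 - (norm z)\<^sup>2) powr \<alpha> * norm (deriv f z)) \<le> S" if "norm z < 1" for z
    unfolding S_def using that by (intro SUP_upper) auto
  \<comment> \<open>The point 0 of the disc gives a nonnegative value, which excludes a supremum of
    minus infinity.\<close>
  have "0 \<le> S"
    using le[of 0] by (rule order_trans[rotated]) simp_all
  moreover have "S < \<infinity>"
    using assms by (cases S) (auto simp: bloch_norm_def S_def)
  ultimately obtain s where s: "S = ereal s" "0 \<le> s"
    by (cases S) auto
  show ?thesis
    by (rule that[OF s(2)]) (use le s(1) in \<open>auto simp: bloch_norm_def S_def\<close>)
qed

lemma bloch_norm_leI: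
  assumes "\<And>z. norm z < 1 \<Longrightarrow> (1 - (norm z)\<^sup>2) powr \<alpha> * norm (deriv f z) \<le> s"
  shows "bloch_norm \<alpha> f \<le> ereal (norm (f 0) + s)"
  unfolding bloch_norm_def plus_ereal.simps(1)[symmetric]
  by (intro add_left_mono SUP_least) (use assms in auto)

text \<open>Since \<open>(norm z)\<^sup>2\<close> is at most \<open>norm z\<close>, the weight may
  be lowered to \<open>1 - norm z\<close>, whose reciprocal has an explicit primitive along a
  radius.\<close>

lemma bloch_deriv_bound:
  assumes "norm z < 1" "(1 - (norm z)\<^sup>2) powr 1 * norm (deriv f z) \<le> s"
  shows "norm (deriv f z) \<le> s / (1 - norm z)"
proof -
  have "(norm z)\<^sup>2 \<le> norm z"
    using assms(1) by (simp add: power2_eq_square mult_left_le)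
  then have "(1 - norm z) * norm (deriv f z) \<le> (1 - (norm z)\<^sup>2) powr 1 * norm (deriv f z)"
    using assms(1) by (intro mult_right_mono) auto
  also note assms(2)
  finally show ?thesis
    using assms(1) by (simp add: field_simps)
qed

text \<open>Mean value inequality on the segment from 0 to \<open>z\<close>: the speed of
  \<open>f (t z)\<close> is at most the derivative of
  \<open>- s * ln (1 - t * norm z)\<close>.\<close>

lemma bloch_growth:
  assumes f: "f holomorphic_on ball 0 1" and z: "norm z < 1"
    and bound: "\<And>z. norm z < 1 \<Longrightarrow> norm (deriv f z) \<le> s / (1 - norm z)"
  shows "norm (f z) \<le> norm (f 0) - s * ln (1 - norm z)"
proof -
  have tz: "norm (of_real t * z) < 1" "t * norm z < 1" if "0 \<le> t" "t \<le> 1" for t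
  proof -
    have "t * norm z \<le> 1 * norm z"
      using that by (intro mult_right_mono) auto
    with z show "t * norm z < 1" by simp
    with that show "norm (of_real t * z) < 1" by (simp add: norm_mult)
  qed
  have fd: "((\<lambda>t. f (of_real t * z)) has_vector_derivative z * deriv f (of_real t * z)) (at t)"
    if "0 \<le> t" "t \<le> 1" for t
  proof -
    have 1: "((\<lambda>t. of_real t * z) has_vector_derivative z) (at t)"
      by (auto intro!: derivative_eq_intros has_vector_derivative_real_field)
    have "(f has_field_derivative deriv f (of_real t * z)) (at (of_real t * z))"
      using tz[OF that] by (intro holomorphic_derivI[OF f]) auto
    from field_vector_diff_chain_at[OF 1 this] show ?thesis
      by (simp add: o_def)
  qed
  have pd: "((\<lambda>t. - s * ln (1 - t * norm z)) has_vector_derivative s * norm z / (1 - t * norm z)) (at t)"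
    if "0 \<le> t" "t \<le> 1" for t
    unfolding has_real_derivative_iff_has_vector_derivative[symmetric] using tz(2)[OF that]
    by (auto intro!: derivative_eq_intros simp: field_simps)
  have "norm (f (of_real 1 * z) - f (of_real 0 * z)) \<le>
      - s * ln (1 - 1 * norm z) - - s * ln (1 - 0 * norm z)"
  proof (rule differentiable_bound_general)
    show "continuous_on {0..1} (\<lambda>t. f (of_real t * z))"
      by (intro continuous_at_imp_continuous_on)
         (auto dest!: has_vector_derivative_continuous[OF fd])
    show "continuous_on {0..1} (\<lambda>t. - s * ln (1 - t * norm z))"
      by (intro continuous_at_imp_continuous_on ballI)
         (rule has_vector_derivative_continuous[OF pd], auto)
  next
    fix t :: real assume t: "0 < t" "t < 1"
    have "norm (z * deriv f (of_real t * z)) \<le> norm z * (s / (1 - norm (of_real t * z)))"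
      unfolding norm_mult[of z] using t by (intro mult_left_mono bound tz) auto
    then show "norm (z * deriv f (of_real t * z)) \<le> s * norm z / (1 - t * norm z)"
      using t by (simp add: norm_mult mult_ac)
  qed (use fd pd in auto)
  then have "norm (f z - f 0) \<le> - s * ln (1 - norm z)" by simp
  then show ?thesis
    using norm_triangle_sub[of "f z" "f 0"] by simp
qed

section \<open>Sufficiency of the tail condition\<close>

context disc_measure
begin

text \<open>After the layer cake formula, the tail condition bounds the integrand pointwise by
  \<open>H'\<close>, which is chosen to have the explicit primitive \<open>H\<close>; only
  \<open>H 1\<close> survives in the bound.\<close>

lemma nn_integral_log_kernel_le:
  fixes \<beta> r K :: real
  assumes \<beta>: "0 < \<beta>" "\<beta> \<le> 2" and r: "0 \<le> r" "r < 1" and K: "0 \<le> K"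
    and tail: "\<And>t. 0 \<le> t \<Longrightarrow> t < 1 \<Longrightarrow>
      measure \<mu> {t..<1} * (1 - ln (1 - t)) \<le> K * (1 - t) powr (2 - \<beta>)"
  shows "(\<integral>\<^sup>+t. ennreal ((1 - ln (1 - t * r)) / (1 - t * r)\<^sup>2) \<partial>\<mu>) \<le>
    ennreal (measure \<mu> (space \<mu>) + 3 * K / \<beta> * (1 - r) powr (- \<beta>))"
proof -
  define G where "G t = (1 - ln (1 - t * r)) / (1 - t * r)\<^sup>2" for t
  define G' where "G' t = r * (1 + 2 * (1 - ln (1 - t * r))) / (1 - t * r) ^ 3" for t
  define H where "H t = 3 * K / \<beta> * (1 - t * r) powr (- \<beta>)" for t
  define H' where "H' t = 3 * K * r * (1 - t * r) powr (- \<beta> - 1)" for t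
  have tr: "t * r < 1" "t * r \<le> t" if "0 \<le> t" "t \<le> 1" for t
  proof -
    show "t * r \<le> t" using that r by (simp add: mult_left_le)
    have "t * r \<le> 1 * r"
      using that r by (intro mult_right_mono) auto
    with r show "t * r < 1" by simp
  qed
  have [measurable]: "G' \<in> borel_measurable borel" "H' \<in> borel_measurable borel"
    unfolding G'_def[abs_def] H'_def[abs_def] by measurable
  have L: "1 \<le> 1 - ln (1 - t * r)" if "0 \<le> t" "t \<le> 1" for t
    using tr[OF that] that r by simp
  have GG': "(G has_real_derivative G' t) (at t)" if "0 \<le> t" "t < 1" for t
  proof -
    define x where "x = 1 - t * r"
    have x: "0 < x" using tr[of t] that by (simp add: x_def)
    have "((\<lambda>x. (1 - ln x) / x\<^sup>2) has_real_derivative - (1 + 2 * (1 - ln x)) / x ^ 3) (at x)"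
      using x by (auto intro!: derivative_eq_intros simp: field_simps eval_nat_numeral)
    moreover have "((\<lambda>t. 1 - t * r) has_real_derivative - r) (at t)"
      by (auto intro!: derivative_eq_intros)
    ultimately have "((\<lambda>t. (1 - ln (1 - t * r)) / (1 - t * r)\<^sup>2) has_real_derivative
        - (1 + 2 * (1 - ln (1 - t * r))) / (1 - t * r) ^ 3 * - r) (at t)"
      unfolding x_def by (rule DERIV_chain2)
    then show ?thesis
      unfolding G_def[abs_def] G'_def
      by (rule DERIV_cong) (simp add: minus_divide_left algebra_simps)
  qed
  have G'0: "0 \<le> G' t" if "0 \<le> t" "t < 1" for t
  proof -
    have t: "t \<le> 1" using that by simp
    have "0 \<le> 1 + 2 * (1 - ln (1 - t * r))" 
      by (intro add_nonneg_nonneg mult_nonneg_nonneg order_trans[OF zero_le_one L[OF that(1) t]]) auto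
    moreover have "0 \<le> 1 - t * r" using tr(1)[OF that(1) t] by linarith
    ultimately show ?thesis
      unfolding G'_def using r by (intro divide_nonneg_nonneg mult_nonneg_nonneg zero_le_power)
  qed
  \<comment> \<open>The endpoint t = 1 is included because r < 1 keeps \<open>1 - t * r\<close>
    positive there, so the fundamental theorem applies on the closed interval.\<close>
  have HH': "(H has_real_derivative H' t) (at t)" if "0 \<le> t" "t \<le> 1" for t
  proof -
    have "1 - t * r > 0" using tr[of t] that by simp
    from has_real_derivative_powr[OF this, of "- \<beta>"]
    have "((\<lambda>t. (1 - t * r) powr (- \<beta>)) has_real_derivative
        - \<beta> * (1 - t * r) powr (- \<beta> - 1) * (- r)) (at t)"
      by (rule DERIV_chain2) (auto intro!: derivative_eq_intros)
    from DERIV_cmult[OF this, of "3 * K / \<beta>"] show ?thesis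
      unfolding H_def[abs_def] H'_def using \<beta> by (simp add: mult_ac add.commute)
  qed
  have H'0: "0 \<le> H' t" for t
    using K r by (simp add: H'_def)
  have key: "G' s * measure \<mu> {s..<1} \<le> H' s" if s: "0 \<le> s" "s < 1" for s
  proof -
    define x where "x = 1 - s * r"
    have x: "0 < x" "1 - s \<le> x" using tr[of s] s by (auto simp: x_def)
    have Lx: "1 \<le> 1 - ln x" using L[of s] s by (simp add: x_def)
    \<comment> \<open>The hypothesis is stated at \<open>1 - s\<close>, the kernel lives at the
      larger \<open>x\<close>. The logarithmic factor shrinks and the power grows on passing to
      \<open>x\<close>, the latter because 2 - \<beta> \<ge> 0.\<close>
    have "ln (1 - s) \<le> ln x" using s x by simp
    then have "measure \<mu> {s..<1} * (1 - ln x) \<le> measure \<mu> {s..<1} * (1 - ln (1 - s))"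
      by (intro mult_left_mono) auto
    also have "\<dots> \<le> K * (1 - s) powr (2 - \<beta>)" by (rule tail[OF s])
    also have "\<dots> \<le> K * x powr (2 - \<beta>)"
      using K s x \<beta> by (intro mult_left_mono powr_mono2) auto
    finally have m: "measure \<mu> {s..<1} * (1 - ln x) \<le> K * x powr (2 - \<beta>)" .
    \<comment> \<open>The constant 3 comes from absorbing 1 + 2 L into 3 L, where L =
      \<open>1 - ln x\<close> is at least 1.\<close>
    have "G' s * measure \<mu> {s..<1} \<le> r * (3 * (1 - ln x)) / x ^ 3 * measure \<mu> {s..<1}"
      unfolding G'_def x_def[symmetric] using r x Lx
      by (intro mult_right_mono divide_right_mono mult_left_mono) auto
    also have "\<dots> = 3 * r / x ^ 3 * (measure \<mu> {s..<1} * (1 - ln x))"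
      by simp
    also have "\<dots> \<le> 3 * r / x ^ 3 * (K * x powr (2 - \<beta>))"
      using r x by (intro mult_left_mono m) auto
    also have "\<dots> = 3 * K * r * (x powr (2 - \<beta>) / x powr 3)"
      using x by (simp add: powr_numeral)
    also have "\<dots> = H' s"
      unfolding powr_diff[symmetric] H'_def x_def[symmetric]
      by (simp add: minus_diff_commute)
    finally show ?thesis .
  qed
  have "(\<integral>\<^sup>+t. ennreal (G t) \<partial>\<mu>) = ennreal (G 0) * emeasure \<mu> (space \<mu>) +
      (\<integral>\<^sup>+s. ennreal (G' s) * indicator {0..<1} s * emeasure \<mu> {s..<1} \<partial>lborel)"
    by (rule nn_integral_layer_cake[OF _ GG' G'0]) (simp_all add: G_def)
  \<comment> \<open>Here \<open>G 0 = 1\<close>, so the boundary term is the total mass.\<close>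
  also have "\<dots> \<le> ennreal (measure \<mu> (space \<mu>)) + (\<integral>\<^sup>+s. ennreal (H' s) * indicator {0..1} s \<partial>lborel)"
  proof (intro add_mono nn_integral_mono)
    show "ennreal (G' s) * indicator {0..<1} s * emeasure \<mu> {s..<1} \<le>
        ennreal (H' s) * indicator {0..1} s" for s
      using key[of s] G'0[of s]
      by (auto simp: indicator_def emeasure_eq_measure simp flip: ennreal_mult intro!: ennreal_leI)
  qed (simp add: G_def emeasure_eq_measure)
  also have "(\<integral>\<^sup>+s. ennreal (H' s) * indicator {0..1} s \<partial>lborel) = ennreal (H 1 - H 0)"
    by (rule nn_integral_FTC_Icc) (use HH' H'0 in auto)
  also have "\<dots> \<le> ennreal (H 1)"
    using K \<beta> by (intro ennreal_leI) (simp add: H_def)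
  finally show ?thesis
    using K \<beta> by (simp add: G_def H_def ennreal_plus)
qed

text \<open>By the quotient rule \<open>h'\<close> is f'/(1 - w) + f/(1 - w)^2. Each summand is at
  most \<open>B\<close> times the logarithmic kernel at \<open>norm w\<close>, by the derivative
  bound and the growth bound respectively; hence the factor 2.\<close>

lemma norm_deriv_cesaro_like_le:
  fixes \<beta> K s :: real
  assumes f: "f holomorphic_on ball 0 1" and z: "norm z < 1" and s: "0 \<le> s"
    and bloch: "\<And>z. norm z < 1 \<Longrightarrow> norm (deriv f z) \<le> s / (1 - norm z)"
    and \<beta>: "0 < \<beta>" "\<beta> \<le> 2" and K: "0 \<le> K"
    and tail: "\<And>t. 0 \<le> t \<Longrightarrow> t < 1 \<Longrightarrow>
      measure \<mu> {t..<1} * (1 - ln (1 - t)) \<le> K * (1 - t) powr (2 - \<beta>)"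
  shows "norm (deriv (cesaro_like \<mu> f) z) \<le> 2 * (norm (f 0) + s) *
    (measure \<mu> (space \<mu>) + 3 * K / \<beta> * (1 - norm z) powr (- \<beta>))"
proof -
  define h where "h w = f w / (1 - w)" for w
  define B where "B = norm (f 0) + s"
  let ?G = "\<lambda>t. (1 - ln (1 - t * norm z)) / (1 - t * norm z)\<^sup>2"
  have B: "0 \<le> B" "s \<le> B" "norm (f 0) \<le> B" using s by (auto simp: B_def)
  have h': "norm (deriv h w) \<le> 2 * B * ((1 - ln (1 - norm w)) / (1 - norm w)\<^sup>2)"
    if w: "norm w < 1" for w
  proof -
    have w1: "w \<noteq> 1" "0 < 1 - norm w" using w by auto
    have nw: "1 - norm w \<le> norm (1 - w)"
      by (metis norm_one norm_triangle_ineq2)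
    define L where "L = 1 - ln (1 - norm w)"
    have L: "1 \<le> L" using w by (simp add: L_def)
    have "(f has_field_derivative deriv f w) (at w)"
      using w by (intro holomorphic_derivI[OF f]) auto
    then have "(h has_field_derivative deriv f w / (1 - w) + f w / (1 - w)\<^sup>2) (at w)"
      unfolding h_def[abs_def] using w1
      by (auto intro!: derivative_eq_intros simp: divide_simps power2_eq_square)
    then have "norm (deriv h w) = norm (deriv f w / (1 - w) + f w / (1 - w)\<^sup>2)"
      by (simp add: DERIV_imp_deriv)
    also have "\<dots> \<le> norm (deriv f w) / norm (1 - w) + norm (f w) / (norm (1 - w))\<^sup>2"
      by (metis norm_triangle_ineq norm_divide norm_power)
    also have "\<dots> \<le> (B * L / (1 - norm w)) / (1 - norm w) + B * L / (1 - norm w)\<^sup>2"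
    proof (intro add_mono frac_le power_mono nw)
      have "norm (deriv f w) \<le> s / (1 - norm w)" by (rule bloch[OF w])
      also have "s \<le> B * L" using B L s by (smt (verit) mult_left_le_one_le mult_le_cancel_left1)
      finally show "norm (deriv f w) \<le> B * L / (1 - norm w)"
        using w1 by (simp add: divide_right_mono)
      \<comment> \<open>With \<open>L\<close> as defined, the logarithm in the growth bound is
        \<open>L - 1\<close>; both terms are then absorbed using 1 \<le> \<open>L\<close>.\<close>
      have "norm (f w) \<le> norm (f 0) * 1 + s * (L - 1)"
        using bloch_growth[OF f w bloch] by (simp add: L_def)
      also have "\<dots> \<le> norm (f 0) * L + s * L"
        using s L by (intro add_mono mult_left_mono) auto
      finally show "norm (f w) \<le> B * L" by (simp add: B_def algebra_simps)
    qed (use w1 B L in auto)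
    also have "\<dots> = 2 * B * (L / (1 - norm w)\<^sup>2)"
      by (simp add: power2_eq_square)
    finally show ?thesis by (simp add: L_def)
  qed
  have bound: "norm (of_real t * deriv h (of_real t * z)) \<le> 2 * B * ?G t"
    if "t \<in> space \<mu>" for t
  proof -
    have t: "0 \<le> t" "t < 1" using that by (auto simp: space_eq)
    have "t * norm z \<le> 1 * norm z"
      using t by (intro mult_right_mono) auto
    then have "norm (of_real t * z) < 1" using z t by (simp add: norm_mult)
    from h'[OF this] t have "norm (deriv h (of_real t * z)) \<le> 2 * B * ?G t"
      by (simp add: norm_mult)
    moreover have "t * norm (deriv h (of_real t * z)) \<le> 1 * norm (deriv h (of_real t * z))"
      using t by (intro mult_right_mono) auto
    ultimately show ?thesis using t by (simp add: norm_mult)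
  qed
  have meas: "(\<lambda>t. ennreal (?G t)) \<in> borel_measurable \<mu>"
    by (rule measurable_compose[OF measurable_borelI]) simp_all
  have "ennreal (norm (deriv (cesaro_like \<mu> f) z)) \<le>
      (\<integral>\<^sup>+t. ennreal (norm (of_real t * deriv h (of_real t * z))) \<partial>\<mu>)"
    using integral_norm_bound_ennreal[OF deriv_cesaro_like(1)[OF f z]] deriv_cesaro_like(2)[OF f z]
    by (simp add: h_def[abs_def])
  also have "\<dots> \<le> (\<integral>\<^sup>+t. ennreal (2 * B) * ennreal (?G t) \<partial>\<mu>)"
    using bound B by (intro nn_integral_mono) (simp add: ennreal_leI flip: ennreal_mult')
  also have "\<dots> = ennreal (2 * B) * (\<integral>\<^sup>+t. ennreal (?G t) \<partial>\<mu>)"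
    by (rule nn_integral_cmult[OF meas])
  also have "\<dots> \<le> ennreal (2 * B) *
      ennreal (measure \<mu> (space \<mu>) + 3 * K / \<beta> * (1 - norm z) powr (- \<beta>))"
    by (intro mult_left_mono nn_integral_log_kernel_le \<beta> K tail) (use z in auto)
  also have "\<dots> = ennreal (2 * B * (measure \<mu> (space \<mu>) + 3 * K / \<beta> * (1 - norm z) powr (- \<beta>)))"
    using B by (simp add: ennreal_mult')
  finally show ?thesis
    using B K \<beta> by (subst (asm) ennreal_le_iff) (auto simp: B_def)
qed

text \<open>Because 1 - r^2 = (1 - r)(1 + r), the weight cancels the singular factor of the
  derivative bound and leaves \<open>(1 + r) powr \<beta>\<close>, which is at most 4.\<close>

lemma bloch_bounded_cesaro_likeI:
  fixes \<beta> K :: real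
  assumes \<beta>: "0 < \<beta>" "\<beta> \<le> 2" and K: "0 \<le> K"
    and tail: "\<And>t. 0 \<le> t \<Longrightarrow> t < 1 \<Longrightarrow>
      measure \<mu> {t..<1} * (1 - ln (1 - t)) \<le> K * (1 - t) powr (2 - \<beta>)"
  shows "bloch_bounded (cesaro_like \<mu>) 1 \<beta>"
proof -
  define M where "M = measure \<mu> (space \<mu>)"
  \<comment> \<open>The 12 is 3 times that bound 4.\<close>
  define C where "C = 2 * (M + 12 * K / \<beta>)"
  have M: "0 \<le> M" by (simp add: M_def)
  have main: "bloch_norm \<beta> (cesaro_like \<mu> f) \<le> ereal (M + C) * bloch_norm 1 f"
    if f: "f \<in> bloch_space 1" for f
  proof -
    have hol: "f holomorphic_on ball 0 1" using f by (simp add: bloch_space_def)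
    obtain s where s: "0 \<le> s" "bloch_norm 1 f = ereal (norm (f 0) + s)"
      "\<And>z. norm z < 1 \<Longrightarrow> (1 - (norm z)\<^sup>2) powr 1 * norm (deriv f z) \<le> s"
      using f bloch_normE[of 1 f] unfolding bloch_space_def by blast
    define B where "B = norm (f 0) + s"
    have B: "0 \<le> B" using s by (simp add: B_def)
    have "bloch_norm \<beta> (cesaro_like \<mu> f) \<le> ereal (norm (cesaro_like \<mu> f 0) + C * B)"
    proof (rule bloch_norm_leI)
      fix z :: complex assume z: "norm z < 1"
      define r where "r = norm z"
      have r: "0 \<le> r" "r < 1" using z by (auto simp: r_def)
      have r2: "1 - r\<^sup>2 = (1 - r) * (1 + r)" by (simp add: power2_eq_square algebra_simps)
      have r2': "0 \<le> 1 - r\<^sup>2" "1 - r\<^sup>2 \<le> 1" using r by (auto simp: power_le_one)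
      have p1: "(1 - r\<^sup>2) powr \<beta> \<le> 1"
        using powr_mono2[of \<beta> "1 - r\<^sup>2" 1] \<beta> r2' by simp
      have "(1 - r\<^sup>2) powr \<beta> * (1 - r) powr (- \<beta>) = (1 + r) powr \<beta>"
        using r unfolding r2 powr_mult powr_minus by simp
      also have "\<dots> \<le> 2 powr \<beta>" using r \<beta> by (intro powr_mono2) auto
      also have "\<dots> \<le> 2 powr 2" using \<beta> by (intro powr_mono) auto
      finally have p2: "(1 - r\<^sup>2) powr \<beta> * (1 - r) powr (- \<beta>) \<le> 4" by simp
      have "(1 - r\<^sup>2) powr \<beta> * norm (deriv (cesaro_like \<mu> f) z) \<le>
          (1 - r\<^sup>2) powr \<beta> * (2 * B * (M + 3 * K / \<beta> * (1 - r) powr (- \<beta>)))"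
        unfolding B_def M_def r_def
        by (intro mult_left_mono norm_deriv_cesaro_like_le hol z s(1) bloch_deriv_bound s(3) \<beta> K tail)
           auto
      also have "\<dots> = 2 * B * ((1 - r\<^sup>2) powr \<beta> * M +
          3 * K / \<beta> * ((1 - r\<^sup>2) powr \<beta> * (1 - r) powr (- \<beta>)))"
        by (simp add: algebra_simps)
      also have "\<dots> \<le> 2 * B * (1 * M + 3 * K / \<beta> * 4)"
        using B K \<beta> M by (intro mult_left_mono add_mono mult_right_mono p1 p2) auto
      finally show "(1 - (norm z)\<^sup>2) powr \<beta> * norm (deriv (cesaro_like \<mu> f) z) \<le> C * B"
        by (simp add: C_def r_def mult_ac)
    qed
    \<comment> \<open>The value at 0 is the total mass times \<open>f 0\<close>, which adds
      \<open>M\<close> to the operator constant.\<close>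
    also have "norm (cesaro_like \<mu> f 0) \<le> M * B"
      using s(1) M by (auto simp: cesaro_like_0 norm_mult M_def B_def intro!: mult_left_mono)
    then have "ereal (norm (cesaro_like \<mu> f 0) + C * B) \<le> ereal ((M + C) * B)"
      by (simp add: algebra_simps)
    finally show ?thesis by (simp add: s(2) B_def)
  qed
  have "cesaro_like \<mu> f \<in> bloch_space \<beta>" if f: "f \<in> bloch_space 1" for f
  proof -
    have "bloch_norm 1 f < \<infinity>" using f by (simp add: bloch_space_def)
    then obtain b where "bloch_norm 1 f = ereal b" by (rule bloch_normE)
    with main[OF f] have "bloch_norm \<beta> (cesaro_like \<mu> f) < \<infinity>"
      by (auto intro: le_less_trans)
    then show ?thesis
      using f by (simp add: bloch_space_def holomorphic_cesaro_like)
  qed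
  with main show ?thesis
    unfolding bloch_bounded_def by blast
qed

end

section \<open>The logarithmic test function and necessity of the tail condition\<close>

lemma one_minus_Ln_deriv:
  assumes "norm z < 1"
  shows "((\<lambda>z. 1 - Ln (1 - z)) has_field_derivative 1 / (1 - z)) (at z)"
proof -
  \<comment> \<open>The right half-plane avoids the branch cut of \<open>Ln\<close>.\<close>
  have "0 < Re (1 - z)" using assms complex_Re_le_cmod[of z] by simp
  then have "1 - z \<notin> \<real>\<^sub>\<le>\<^sub>0" by (auto simp: complex_nonpos_Reals_iff)
  then show ?thesis
    by (auto intro!: derivative_eq_intros simp: field_simps)
qed

text \<open>The derivative is 1/(1 - z) and \<open>norm (1 - z)\<close> is at least
  \<open>1 - norm z\<close>, so the weighted derivative is at most \<open>1 + norm z\<close>, hence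
  at most 2.\<close>

lemma one_minus_Ln_in_bloch_space: "(\<lambda>z. 1 - Ln (1 - z)) \<in> bloch_space 1"
proof -
  have "bloch_norm 1 (\<lambda>z. 1 - Ln (1 - z)) \<le> ereal (norm (1 - Ln (1 - 0)) + 2)"
  proof (rule bloch_norm_leI)
    fix z :: complex assume z: "norm z < 1"
    have "1 - norm z \<le> norm (1 - z)"
      by (metis norm_one norm_triangle_ineq2)
    then have "(1 + norm z) * (1 - norm z) \<le> 2 * norm (1 - z)"
      using z by (intro mult_mono) auto
    then have "1 - (norm z)\<^sup>2 \<le> 2 * norm (1 - z)"
      by (simp add: power2_eq_square algebra_simps)
    moreover have "0 < norm (1 - z)" using z by auto
    moreover have "0 \<le> 1 - (norm z)\<^sup>2" using z by (simp add: power_le_one)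
    ultimately show "(1 - (norm z)\<^sup>2) powr 1 * norm (deriv (\<lambda>z. 1 - Ln (1 - z)) z) \<le> 2"
      unfolding DERIV_imp_deriv[OF one_minus_Ln_deriv[OF z]]
      by (simp add: norm_divide divide_le_eq)
  qed
  also have "\<dots> < \<infinity>" by simp
  finally show ?thesis
    unfolding bloch_space_def
    by (metis (mono_tags, lifting) dist_0_norm holomorphic_on_open mem_Collect_eq mem_ball
        one_minus_Ln_deriv open_ball)
qed

context disc_measure
begin

text \<open>At a real point the integrand is real and nonnegative, so the part over [r,1) bounds the
  integral from below. There t \<ge> r and \<open>t * r\<close> \<ge> \<open>r\<^sup>2\<close>, and
  monotonicity replaces the integrand by its value at t = r.\<close>

lemma deriv_cesaro_like_one_minus_Ln:
  fixes r :: real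
  assumes r: "0 < r" "r < 1"
  shows "measure \<mu> {r..<1} * (r * ((2 - ln (1 - r\<^sup>2)) / (1 - r\<^sup>2)\<^sup>2)) \<le>
    norm (deriv (cesaro_like \<mu> (\<lambda>z. 1 - Ln (1 - z))) (of_real r))"
proof -
  let ?f = "\<lambda>z. 1 - Ln (1 - z)"
  let ?h = "\<lambda>w. ?f w / (1 - w)"
  \<comment> \<open>This is \<open>deriv ?h\<close> on the real axis: (1 + f)/(1 - x)^2, the 1
    coming from f' (1 - x) = 1.\<close>
  define g where "g x = (2 - ln (1 - x)) / (1 - x)\<^sup>2" for x :: real
  have hol: "?f holomorphic_on ball 0 1"
    using one_minus_Ln_in_bloch_space by (simp add: bloch_space_def)
  have h': "deriv ?h (of_real x) = of_real (g x)" if x: "0 \<le> x" "x < 1" for x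
  proof -
    have "(?h has_field_derivative
        (1 / (1 - of_real x) + ?f (of_real x) / (1 - of_real x)) / (1 - of_real x)) (at (of_real x))"
    proof -
      have "((\<lambda>w. 1 - w) has_field_derivative - 1) (at (complex_of_real x))"
        by (auto intro!: derivative_eq_intros)
      moreover have "norm (complex_of_real x) < 1" "1 - complex_of_real x \<noteq> 0"
        using x by auto
      ultimately have "(?h has_field_derivative
          (1 / (1 - of_real x) * (1 - of_real x) - ?f (of_real x) * - 1) /
          ((1 - of_real x) * (1 - of_real x))) (at (of_real x))"
        by (intro DERIV_divide one_minus_Ln_deriv)
      then show ?thesis
        by (rule DERIV_cong) (simp flip: add_divide_distrib)
    qed
    moreover have "Ln (1 - complex_of_real x) = of_real (ln (1 - x))"
      using Ln_of_real[of "1 - x"] x by simp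
    ultimately show ?thesis
      by (simp add: DERIV_imp_deriv g_def power2_eq_square flip: add_divide_distrib)
  qed
  have tr: "0 \<le> t * r" "t * r < 1" if "t \<in> space \<mu>" for t
    using that r mult_strict_mono[of t 1 r 1] by (auto simp: space_eq)
  have eq: "of_real t * deriv ?h (of_real t * of_real r) = complex_of_real (t * g (t * r))"
    if "t \<in> space \<mu>" for t
    using h'[OF tr[OF that]] by simp
  have nr: "norm (complex_of_real r) < 1" using r by simp
  have "integrable \<mu> (\<lambda>t. complex_of_real (t * g (t * r)))"
    using deriv_cesaro_like(1)[OF hol nr]
    by (rule Bochner_Integration.integrable_cong[THEN iffD1, rotated 2]) (simp_all only: eq)
  then have int: "integrable \<mu> (\<lambda>t. t * g (t * r))"
    by (simp only: complex_of_real_integrable_eq)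
  have "deriv (cesaro_like \<mu> ?f) (of_real r) = (LINT t|\<mu>. complex_of_real (t * g (t * r)))"
    unfolding deriv_cesaro_like(2)[OF hol nr]
    by (rule Bochner_Integration.integral_cong) (simp_all only: eq)
  then have norm_eq: "norm (deriv (cesaro_like \<mu> ?f) (of_real r)) = \<bar>LINT t|\<mu>. t * g (t * r)\<bar>"
    by (simp only: integral_complex_of_real norm_of_real)
  have "{r..<1} \<inter> space \<mu> = {r..<1}" using r by (auto simp: space_eq)
  then have "measure \<mu> {r..<1} * (r * g (r\<^sup>2)) =
      (LINT t|\<mu>. indicator {r..<1} t * (r * g (r\<^sup>2)))"
    by simp
  also have "\<dots> \<le> (LINT t|\<mu>. t * g (t * r))"
  proof (rule integral_mono[OF _ int])
    show "integrable \<mu> (\<lambda>t. indicator {r..<1} t * (r * g (r\<^sup>2)))"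
      using Ico_in_sets[of r] r by (auto intro!: integrable_mult_left integrable_real_indicator
        simp: emeasure_eq_measure)
    fix t assume t: "t \<in> space \<mu>"
    have g0: "0 \<le> g (t * r)"
      using tr[OF t] ln_le_minus_one[of "1 - t * r"] by (simp add: g_def)
    show "indicator {r..<1} t * (r * g (r\<^sup>2)) \<le> t * g (t * r)"
    proof (cases "r \<le> t")
      case True
      have le: "r\<^sup>2 \<le> t * r" using True r by (simp add: power2_eq_square)
      have "ln (1 - t * r) \<le> ln (1 - r\<^sup>2)" "(1 - t * r)\<^sup>2 \<le> (1 - r\<^sup>2)\<^sup>2"
        using le tr[OF t] by (auto intro!: power_mono)
      moreover have "ln (1 - r\<^sup>2) \<le> 0" using r le tr[OF t] by simp
      ultimately have "g (r\<^sup>2) \<le> g (t * r)"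
        unfolding g_def using tr[OF t] by (intro frac_le) auto
      then have "r * g (r\<^sup>2) \<le> t * g (t * r)"
        using True r g0 by (intro mult_mono') (auto simp: g_def intro!: divide_nonneg_nonneg
          order_trans[OF \<open>ln (1 - r\<^sup>2) \<le> 0\<close>])
      then show ?thesis using True t by (simp add: space_eq)
    next
      case False
      then show ?thesis using g0 t by (simp add: space_eq)
    qed
  qed
  also have "\<dots> \<le> norm (deriv (cesaro_like \<mu> ?f) (of_real r))"
    unfolding norm_eq by simp
  finally show ?thesis by (simp only: g_def)
qed

text \<open>The lower bound for the test function is evaluated at z = t. Its factor t degenerates
  near 0, so t < 1/2 is treated separately with the total mass.\<close>

lemma tail_bound_of_bloch_bounded:
  fixes \<beta> :: real
  assumes bdd: "bloch_bounded (cesaro_like \<mu>) 1 \<beta>" and \<beta>: "0 < \<beta>" "\<beta> \<le> 2"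
  obtains K where "\<And>t. 0 < t \<Longrightarrow> t < 1 \<Longrightarrow>
    measure \<mu> {t..<1} * (1 - ln (1 - t)) / (1 - t) powr (2 - \<beta>) \<le> K"
proof -
  let ?F = "cesaro_like \<mu> (\<lambda>z. 1 - Ln (1 - z))"
  have "bloch_norm \<beta> ?F < \<infinity>"
    using bdd one_minus_Ln_in_bloch_space by (auto simp: bloch_bounded_def bloch_space_def)
  then obtain s where s: "0 \<le> s" "bloch_norm \<beta> ?F = ereal (norm (?F 0) + s)"
    "\<And>z. norm z < 1 \<Longrightarrow> (1 - (norm z)\<^sup>2) powr \<beta> * norm (deriv ?F z) \<le> s"
    by (rule bloch_normE) (erule that, assumption+)
  define M where "M = measure \<mu> (space \<mu>)"
  \<comment> \<open>Small t: numerator at most 2 M, denominator at least 1/4. Other t: a factor 2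
    from t \<ge> 1/2 and a factor 4 from \<open>2 powr (2 - \<beta>)\<close>.\<close>
  have "measure \<mu> {t..<1} * (1 - ln (1 - t)) / (1 - t) powr (2 - \<beta>) \<le> max (8 * M) (8 * s)"
    if t: "0 < t" "t < 1" for t
  proof -
    define m where "m = measure \<mu> {t..<1}"
    have m: "0 \<le> m" "m \<le> M"
      using bounded_measure by (auto simp: m_def M_def)
    have L: "1 \<le> 1 - ln (1 - t)" using t by simp
    show ?thesis
    proof (cases "t < 1 / 2")
      case True
      have "ln (1 / 2) \<le> ln (1 - t)" using True by simp
      then have "1 - ln (1 - t) \<le> 2" using ln_2_less_1 by (simp add: ln_div)
      then have 1: "m * (1 - ln (1 - t)) \<le> M * 2"
        using m L by (intro mult_mono) auto
      have "(1 / 2) powr 2 \<le> (1 / 2) powr (2 - \<beta>)"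
        using \<beta> by (intro powr_mono') auto
      also have "\<dots> \<le> (1 - t) powr (2 - \<beta>)"
        using \<beta> True by (intro powr_mono2) auto
      finally have "1 / 4 \<le> (1 - t) powr (2 - \<beta>)"
        by (simp add: powr_numeral power2_eq_square)
      then have "m * (1 - ln (1 - t)) / (1 - t) powr (2 - \<beta>) \<le> M * 2 / (1 / 4)"
        using 1 m by (intro frac_le) auto
      then show ?thesis by (simp add: m_def)
    next
      case False
      define x where "x = 1 - t\<^sup>2"
      have x_eq: "x = (1 - t) * (1 + t)" by (simp add: x_def power2_eq_square algebra_simps)
      have x: "0 < x" "x \<le> 2 * (1 - t)"
        using t mult_left_mono[of "1 + t" 2 "1 - t"] by (auto simp: x_eq)
      \<comment> \<open>The 2 in the numerator of the lower bound, against the 1 in the tail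
        condition, pays for \<open>ln (1 + t)\<close> when \<open>1 - t\<^sup>2\<close> is traded
        for \<open>1 - t\<close>.\<close>
      have "ln x = ln (1 - t) + ln (1 + t)" using t by (simp add: x_eq ln_mult)
      moreover have "ln (1 + t) \<le> 1" using t ln_add_one_self_le_self[of t] by simp
      ultimately have Lx: "1 - ln (1 - t) \<le> 2 - ln x" by simp
      have "x powr \<beta> * (m * (t * ((2 - ln x) / x\<^sup>2))) \<le> x powr \<beta> * norm (deriv ?F (of_real t))"
        unfolding m_def x_def by (intro mult_left_mono deriv_cesaro_like_one_minus_Ln t) auto
      also have "\<dots> \<le> s" using s(3)[of "of_real t"] t by (simp add: x_def)
      also have "x powr \<beta> * (m * (t * ((2 - ln x) / x\<^sup>2))) = m * t * (2 - ln x) / x powr (2 - \<beta>)"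
        using x by (simp add: powr_diff powr_numeral)
      finally have "m * t * (2 - ln x) \<le> s * x powr (2 - \<beta>)"
        using x by (simp add: field_simps)
      moreover have "m * (1 / 2) * (1 - ln (1 - t)) \<le> m * t * (2 - ln x)"
        using m False t by (intro mult_mono Lx order_trans[OF zero_le_one L]) auto
      moreover have "s * x powr (2 - \<beta>) \<le> s * (4 * (1 - t) powr (2 - \<beta>))"
      proof (rule mult_left_mono[OF _ s(1)])
        have "x powr (2 - \<beta>) \<le> (2 * (1 - t)) powr (2 - \<beta>)"
          using x \<beta> by (intro powr_mono2) auto
        also have "\<dots> = 2 powr (2 - \<beta>) * (1 - t) powr (2 - \<beta>)"
          by (rule powr_mult)
        also have "\<dots> \<le> 2 powr 2 * (1 - t) powr (2 - \<beta>)"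
          using \<beta> by (intro mult_right_mono powr_mono) auto
        finally show "x powr (2 - \<beta>) \<le> 4 * (1 - t) powr (2 - \<beta>)" by simp
      qed
      ultimately have "m * (1 - ln (1 - t)) \<le> 8 * s * (1 - t) powr (2 - \<beta>)" by simp
      then have "m * (1 - ln (1 - t)) / (1 - t) powr (2 - \<beta>) \<le> 8 * s"
        using t by (simp add: divide_le_eq)
      then show ?thesis by (simp add: m_def le_max_iff_disj)
    qed
  qed
  then show ?thesis by (rule that)
qed

end

section \<open>From the extended supremum to real bounds, and the equivalence\<close>

lemma SUP_ereal_less_PInf_iff:
  fixes g :: "'a \<Rightarrow> real"
  shows "(SUP x \<in> A. ereal (g x)) < \<infinity> \<longleftrightarrow> (\<exists>K. \<forall>x \<in> A. g x \<le> K)"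
proof
  assume "(SUP x \<in> A. ereal (g x)) < \<infinity>"
  then obtain n :: nat where "(SUP x \<in> A. ereal (g x)) < ereal (real n)"
    by (auto simp: less_PInf_Ex_of_nat)
  then show "\<exists>K. \<forall>x \<in> A. g x \<le> K"
    by (metis SUP_lessD ereal_less_eq(3) less_imp_le)
next
  assume "\<exists>K. \<forall>x \<in> A. g x \<le> K"
  then obtain K where "\<forall>x \<in> A. g x \<le> K" ..
  then have "(SUP x \<in> A. ereal (g x)) \<le> ereal K" by (intro SUP_least) auto
  then show "(SUP x \<in> A. ereal (g x)) < \<infinity>" by (rule le_less_trans) simp
qed

theorem theorem3p3:
  fixes \<mu> :: "real measure" and \<beta> :: real
  assumes "finite_measure \<mu>"
    and "sets \<mu> = sets (restrict_space borel {0..<1})"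
    and "0 < \<beta>" and "\<beta> \<le> 2"
  shows "bloch_bounded (cesaro_like \<mu>) 1 \<beta> \<longleftrightarrow>
    (SUP t \<in> {0<..<1}.
       ereal (measure \<mu> {t..<1} * ln (exp 1 / (1 - t)) / (1 - t) powr (2 - \<beta>))) < \<infinity>"
proof -
  interpret disc_measure \<mu>
    using assms(1,2) by (simp add: disc_measure_def disc_measure_axioms_def)
  have ln_eq: "ln (exp 1 / (1 - t)) = 1 - ln (1 - t)" if "t < 1" for t :: real
    using that by (simp add: ln_div)
  show ?thesis
    unfolding SUP_ereal_less_PInf_iff
  proof
    assume "bloch_bounded (cesaro_like \<mu>) 1 \<beta>"
    then obtain K where "\<And>t. 0 < t \<Longrightarrow> t < 1 \<Longrightarrow>
        measure \<mu> {t..<1} * (1 - ln (1 - t)) / (1 - t) powr (2 - \<beta>) \<le> K"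
      using tail_bound_of_bloch_bounded assms(3,4) by blast
    then show "\<exists>K. \<forall>t\<in>{0<..<1}.
        measure \<mu> {t..<1} * ln (exp 1 / (1 - t)) / (1 - t) powr (2 - \<beta>) \<le> K"
      by (intro exI[of _ K]) (simp add: ln_eq)
  next
    assume "\<exists>K. \<forall>t\<in>{0<..<1}.
        measure \<mu> {t..<1} * ln (exp 1 / (1 - t)) / (1 - t) powr (2 - \<beta>) \<le> K"
    then obtain K where "\<forall>t\<in>{0<..<1}.
        measure \<mu> {t..<1} * ln (exp 1 / (1 - t)) / (1 - t) powr (2 - \<beta>) \<le> K" ..
    then have K: "measure \<mu> {t..<1} * (1 - ln (1 - t)) / (1 - t) powr (2 - \<beta>) \<le> K"
      if "0 < t" "t < 1" for t
      using that by (simp add: ln_eq)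
    \<comment> \<open>The supremum omits t = 0. There the logarithmic factor and the power are both
      1, so the total mass is the bound required; it also makes \<open>K'\<close>
      nonnegative.\<close>
    define K' where "K' = max K (measure \<mu> (space \<mu>))"
    show "bloch_bounded (cesaro_like \<mu>) 1 \<beta>"
    proof (rule bloch_bounded_cesaro_likeI[OF assms(3,4), of K'])
      show "0 \<le> K'" by (simp add: K'_def le_max_iff_disj)
      fix t :: real assume t: "0 \<le> t" "t < 1"
      show "measure \<mu> {t..<1} * (1 - ln (1 - t)) \<le> K' * (1 - t) powr (2 - \<beta>)"
      proof (cases "t = 0")
        case True
        then show ?thesis using bounded_measure[of "{0..<1}"] by (simp add: K'_def)
      next
        case False
        then have "measure \<mu> {t..<1} * (1 - ln (1 - t)) / (1 - t) powr (2 - \<beta>) \<le> K'"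
          using K[of t] t by (simp add: K'_def)
        then show ?thesis using t by (simp add: divide_le_eq)
      qed
    qed
  qed
qed

end
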